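(* Let $\sigma$ and $\pi$ be permutations, and let $m_1=(\sigma,R_1)$ and $m_2=(\sigma,R_2)$ be mesh patterns with the same underlying classical pattern $\sigma$. Regard $\pi=(\pi,\emptyset)$ as a (dominating) classical pattern and assume $|\pi|\le|\sigma|+1$. Suppose there is a box $(a,b)\in[0,|\sigma|]\times[0,|\sigma|]$ such that 1. $R_2=R_1\cup\{(a,b)\}$, and 2. $\pi\preceq\sigma^{(a,b)}$. Then $m_1$ and $m_2$ are coincident under $\pi$, i.e. $\mathrm{Av}(\{\pi,m_1\})=\mathrm{Av}(\{\pi,m_2\})$.
   Context: Write $[n]=\{1,\dots,n\}$ and $[0,k]=\{0,1,\dots,k\}$. A permutation of length $n$ is a bijection of $[n]$, written in one-line notation; $|\sigma|$ is the length of $\sigma$ and $G(\sigma)=\{(i,\sigma(i)) : i\in[n]\}$ is its plot. For permutations, $\sigma\preceq\pi$ means that $\pi$ contains $\sigma$ as a classical pattern, i.e. some subsequence of $\pi$ is order isomorphic to $\sigma$. A mesh pattern of length $k$ is a pair $p=(\tau,R)$ with $\tau$ a permutation of length $k$ (the underlying classical pattern) and $R\subseteq[0,k]\times[0,k]$; the element $(i,j)$ of $[0,k]\times[0,k]$ denotes the unit box with lower left corner $(i,j)$. An occurrence of $p$ in a permutation $\pi$ of length $n$ is a subset $\omega\subseteq G(\pi)$ for which there are order-preserving injections $\alpha,\beta:[k]\to[n]$ such that (i) $\omega=\{(\alpha(i),\beta(j)):(i,j)\in G(\tau)\}$, and (ii) with $\alpha(0)=\beta(0)=0$, $\alpha(k+1)=\beta(k+1)=n+1$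 and $R_{ij}=[\alpha(i)+1,\alpha(i+1)-1]\times[\beta(j)+1,\beta(j+1)-1]$ (the region corresponding to the box $(i,j)$), one has $R_{ij}\cap G(\pi)=\emptyset$ for every $(i,j)\in R$. A permutation contains $p$ if it has an occurrence of $p$, and avoids $p$ otherwise. A classical pattern $\pi$ is identified with the mesh pattern $(\pi,\emptyset)$. $\mathrm{Av}(S)$ is the set of all permutations (of all lengths) avoiding every pattern in $S$. Two mesh patterns $p_1,p_2$ are coincident under $\pi$ if $\mathrm{Av}(\{\pi,p_1\})=\mathrm{Av}(\{\pi,p_2\})$. For a permutation $\sigma$ of length $n$ and a box $(a,b)\in[0,n]^2$, $\sigma^{(a,b)}$ is the permutation of length $n+1$ obtained by inserting a point in the box $(a,b)$ of the plot of $\sigma$: $\sigma^{(a,b)}(a+1)=b+1$; for $k\le a$, $\sigma^{(a,b)}(k)=\sigma(k)$ if $\sigma(k)\le b$ and $\sigma(k)+1$ otherwise; for $k>a+1$, $\sigma^{(a,b)}(k)=\sigma(k-1)$ if $\sigma(k-1)\le b$ and $\sigma(k-1)+1$ otherwise. *)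

theory Defs
  imports "HOL-Combinatorics.Multiset_Permutations" "HOL-Library.Sublist"
begin

(* A permutation of length n is represented by its one-line notation, a list that is
   an arrangement of {1..n}.  The empty permutation (n = 0) is included. *)
type_synonym permutation = "nat list"

definition is_perm :: "permutation \<Rightarrow> bool" where
  "is_perm \<sigma> \<longleftrightarrow> \<sigma> \<in> permutations_of_set {1..length \<sigma>}"

(* The value sigma(i) for i in {1..n}; positions are counted from 1, list indices from 0. *)
definition perm_at :: "permutation \<Rightarrow> nat \<Rightarrow> nat" where
  "perm_at \<sigma> i = \<sigma> ! (i - 1)"

definition plot :: "permutation \<Rightarrow> (nat \<times> nat) set" where
  "plot \<sigma> = {(i, perm_at \<sigma> i) | i. i \<in> {1..length \<sigma>}}"

definition order_isomorphic :: "nat list \<Rightarrow> nat list \<Rightarrow> bool" where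
  "order_isomorphic xs ys \<longleftrightarrow> length xs = length ys \<and>
     (\<forall>i < length xs. \<forall>j < length xs. xs ! i < xs ! j \<longleftrightarrow> ys ! i < ys ! j)"

definition pattern_le :: "permutation \<Rightarrow> permutation \<Rightarrow> bool"  (infix "\<preceq>" 50) where
  "\<sigma> \<preceq> \<pi> \<longleftrightarrow> (\<exists>xs. subseq xs \<pi> \<and> order_isomorphic xs \<sigma>)"

type_synonym mesh_pattern = "permutation \<times> (nat \<times> nat) set"

definition is_mesh_pattern :: "mesh_pattern \<Rightarrow> bool" where
  "is_mesh_pattern p \<longleftrightarrow> (case p of (\<tau>, R) \<Rightarrow>
     is_perm \<tau> \<and> R \<subseteq> {0..length \<tau>} \<times> {0..length \<tau>})"

abbreviation classical :: "permutation \<Rightarrow> mesh_pattern" where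
  "classical \<pi> \<equiv> (\<pi>, {})"

(* The injections [k] -> [n] are total functions on nat; their values at 0 and k + 1 are the
   boundary conventions, and values beyond k + 1 are never used.  The subtractions below do
   not truncate, since alpha (i + 1) and beta (j + 1) are positive for i, j in {0..k}. *)
definition occurrence :: "mesh_pattern \<Rightarrow> permutation \<Rightarrow> (nat \<times> nat) set \<Rightarrow> bool" where
  "occurrence p \<pi> \<omega> \<longleftrightarrow> (case p of (\<tau>, R) \<Rightarrow> let k = length \<tau>; n = length \<pi> in
     \<omega> \<subseteq> plot \<pi> \<and>
     (\<exists>\<alpha> \<beta>.
        \<alpha> ` {1..k} \<subseteq> {1..n} \<and> strict_mono_on {1..k} \<alpha> \<and>
        \<beta> ` {1..k} \<subseteq> {1..n} \<and> strict_mono_on {1..k} \<beta> \<and>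
        \<omega> = {(\<alpha> i, \<beta> j) | i j. (i, j) \<in> plot \<tau>} \<and>
        \<alpha> 0 = 0 \<and> \<beta> 0 = 0 \<and> \<alpha> (k + 1) = n + 1 \<and> \<beta> (k + 1) = n + 1 \<and>
        (\<forall>(i, j) \<in> R.
           ({\<alpha> i + 1 .. \<alpha> (i + 1) - 1} \<times> {\<beta> j + 1 .. \<beta> (j + 1) - 1}) \<inter> plot \<pi> = {})))"

definition contains_mesh :: "permutation \<Rightarrow> mesh_pattern \<Rightarrow> bool" where
  "contains_mesh \<pi> p \<longleftrightarrow> (\<exists>\<omega>. occurrence p \<pi> \<omega>)"

definition Av :: "mesh_pattern set \<Rightarrow> permutation set" where
  "Av S = {\<pi>. is_perm \<pi> \<and> (\<forall>p \<in> S. \<not> contains_mesh \<pi> p)}"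

definition coincident_under :: "permutation \<Rightarrow> mesh_pattern \<Rightarrow> mesh_pattern \<Rightarrow> bool" where
  "coincident_under \<pi> p1 p2 \<longleftrightarrow> Av {classical \<pi>, p1} = Av {classical \<pi>, p2}"

(* sigma^(a,b): the new point gets position a + 1 and value b + 1. *)
definition insert_point :: "permutation \<Rightarrow> nat \<times> nat \<Rightarrow> permutation" where
  "insert_point \<sigma> = (\<lambda>(a, b).
     let raise = (\<lambda>v. if v \<le> b then v else v + 1) in
     map (\<lambda>k. if k \<le> a then raise (perm_at \<sigma> k)
              else if k = a + 1 then b + 1
              else raise (perm_at \<sigma> (k - 1)))
       [1..<length \<sigma> + 2])"

end

theory Submission
  imports Defs
begin

text \<open>
  Adding \<open>(a, b)\<close> to the mesh can only destroy those occurrences of \<open>m1\<close> whose region for the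
  box \<open>(a, b)\<close> contains a point of the host permutation.  Such a point together with the
  occurrence forms a copy of \<open>insert_point \<sigma> (a, b)\<close>, hence the host already contains \<open>\<pi>\<close>.
\<close>

section \<open>Pattern containment as maps between positions\<close>

text \<open>Classical containment recorded only by a map on 1-based positions. Such maps compose,
  and \<open>f\<close> has the same domain and range as the \<open>\<alpha>\<close> of an
  occurrence; the value map is recovered later.\<close>

definition embeds :: "permutation \<Rightarrow> permutation \<Rightarrow> bool" where
  "embeds \<sigma> \<rho> \<longleftrightarrow> (\<exists>f. f ` {1..length \<sigma>} \<subseteq> {1..length \<rho>} \<and> strict_mono_on {1..length \<sigma>} f \<and>
     (\<forall>i \<in> {1..length \<sigma>}. \<forall>j \<in> {1..length \<sigma>}.
        perm_at \<sigma> i < perm_at \<sigma> j \<longleftrightarrow> perm_at \<rho> (f i) < perm_at \<rho> (f j)))"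

lemma embeds_trans:
  assumes "embeds \<pi> \<sigma>" "embeds \<sigma> \<rho>"
  shows "embeds \<pi> \<rho>"
proof -
  obtain f where f: "f ` {1..length \<pi>} \<subseteq> {1..length \<sigma>}" "strict_mono_on {1..length \<pi>} f"
    "\<forall>i \<in> {1..length \<pi>}. \<forall>j \<in> {1..length \<pi>}.
        perm_at \<pi> i < perm_at \<pi> j \<longleftrightarrow> perm_at \<sigma> (f i) < perm_at \<sigma> (f j)"
    using assms(1) unfolding embeds_def by blast
  obtain g where g: "g ` {1..length \<sigma>} \<subseteq> {1..length \<rho>}" "strict_mono_on {1..length \<sigma>} g"
    "\<forall>i \<in> {1..length \<sigma>}. \<forall>j \<in> {1..length \<sigma>}.
        perm_at \<sigma> i < perm_at \<sigma> j \<longleftrightarrow> perm_at \<rho> (g i) < perm_at \<rho> (g j)"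
    using assms(2) unfolding embeds_def by blast
  have f_in: "f i \<in> {1..length \<sigma>}" if "i \<in> {1..length \<pi>}" for i
    using f(1) that by blast
  have "strict_mono_on {1..length \<pi>} (g \<circ> f)"
    using f(2) g(2) f_in by (simp add: strict_mono_on_def)
  moreover have "(g \<circ> f) ` {1..length \<pi>} \<subseteq> {1..length \<rho>}"
    using f_in g(1) by (simp add: image_subset_iff)
  moreover have "\<forall>i \<in> {1..length \<pi>}. \<forall>j \<in> {1..length \<pi>}.
      perm_at \<pi> i < perm_at \<pi> j \<longleftrightarrow> perm_at \<rho> ((g \<circ> f) i) < perm_at \<rho> ((g \<circ> f) j)"
    using f(3) g(3) f_in by simp
  ultimately show ?thesis
    unfolding embeds_def by blast
qed

text \<open>Induction along the embedding: skipping a head of \<open>ys\<close> shifts every index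
  by one, while matching heads sends 0 to 0 and shifts the rest.\<close>

lemma subseq_index_map:
  assumes "subseq xs ys"
  shows "\<exists>f. f ` {..<length xs} \<subseteq> {..<length ys} \<and> strict_mono_on {..<length xs} f \<and>
           (\<forall>i < length xs. xs ! i = ys ! f i)"
  using assms
proof (induction rule: list_emb.induct)
  case (list_emb_Nil ys)
  show ?case by (simp add: strict_mono_on_def)
next
  case (list_emb_Cons xs ys y)
  then obtain f where f: "f ` {..<length xs} \<subseteq> {..<length ys}" "strict_mono_on {..<length xs} f"
    "\<forall>i < length xs. xs ! i = ys ! f i" by blast
  show ?case
    by (rule exI[of _ "Suc \<circ> f"]) (use f in \<open>auto simp: strict_mono_on_def\<close>)
next
  case (list_emb_Cons2 x y xs ys)
  then obtain f where f: "f ` {..<length xs} \<subseteq> {..<length ys}" "strict_mono_on {..<length xs} f"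
    "\<forall>i < length xs. xs ! i = ys ! f i" by blast
  show ?case
    by (rule exI[of _ "case_nat 0 (Suc \<circ> f)"])
      (use f list_emb_Cons2.hyps in
        \<open>auto simp: strict_mono_on_def nth_Cons image_subset_iff split: nat.splits\<close>)
qed

lemma pattern_le_imp_embeds:
  assumes "\<pi> \<preceq> \<rho>"
  shows "embeds \<pi> \<rho>"
proof -
  obtain xs where xs: "subseq xs \<rho>" "order_isomorphic xs \<pi>"
    using assms unfolding pattern_le_def by blast
  have len: "length xs = length \<pi>"
    using xs(2) by (simp add: order_isomorphic_def)
  obtain f where f: "f ` {..<length \<pi>} \<subseteq> {..<length \<rho>}" "strict_mono_on {..<length \<pi>} f"
    "\<forall>i < length \<pi>. xs ! i = \<rho> ! f i"
    using subseq_index_map[OF xs(1)] len by auto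
  \<comment> \<open>Translates the 0-based list indices of \<open>f\<close> into 1-based positions;
    \<open>i - 1\<close> does not truncate for positions i \<ge> 1.\<close>
  let ?g = "\<lambda>i. Suc (f (i - 1))"
  have "?g ` {1..length \<pi>} \<subseteq> {1..length \<rho>}"
  proof (rule image_subsetI)
    fix i assume "i \<in> {1..length \<pi>}"
    then have "f (i - 1) < length \<rho>"
      using f(1) by (auto simp: image_subset_iff)
    then show "?g i \<in> {1..length \<rho>}" by simp
  qed
  moreover have "strict_mono_on {1..length \<pi>} ?g"
  proof (rule strict_mono_onI)
    fix i j assume "i \<in> {1..length \<pi>}" "j \<in> {1..length \<pi>}" "i < j"
    then have "f (i - 1) < f (j - 1)"
      by (intro strict_mono_onD[OF f(2)]) auto
    then show "?g i < ?g j" by simp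
  qed
  moreover have "\<forall>i \<in> {1..length \<pi>}. \<forall>j \<in> {1..length \<pi>}.
      perm_at \<pi> i < perm_at \<pi> j \<longleftrightarrow> perm_at \<rho> (?g i) < perm_at \<rho> (?g j)"
  proof (intro ballI)
    fix i j assume "i \<in> {1..length \<pi>}" "j \<in> {1..length \<pi>}"
    then have "i - 1 < length \<pi>" "j - 1 < length \<pi>" by auto
    then show "perm_at \<pi> i < perm_at \<pi> j \<longleftrightarrow> perm_at \<rho> (?g i) < perm_at \<rho> (?g j)"
      using f(3) xs(2) len by (simp add: perm_at_def order_isomorphic_def)
  qed
  ultimately show ?thesis
    unfolding embeds_def by blast
qed

section \<open>From position maps to occurrences\<close>

lemma perm_at_bij_betw:
  assumes "is_perm \<sigma>"
  shows "bij_betw (perm_at \<sigma>) {1..length \<sigma>} {1..length \<sigma>}"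
proof -
  have \<sigma>: "set \<sigma> = {1..length \<sigma>}" "distinct \<sigma>"
    using assms by (auto simp: is_perm_def permutations_of_set_def)
  have "bij_betw (\<lambda>i. i - 1) {1..length \<sigma>} {..<length \<sigma>}"
    by (rule bij_betwI[where g = Suc]) auto
  from bij_betw_trans[OF this bij_betw_nth[OF \<sigma>(2) refl \<sigma>(1)[symmetric]]]
  show ?thesis
    by (simp add: perm_at_def[abs_def] comp_def)
qed

text \<open>The mesh is empty, so only a value map has to be found. It sends a value j of \<pi> to
  the entry of \<rho> over the position where \<pi> takes the value j; it is increasing because
  \<open>f\<close> preserves the order of entries.\<close>

lemma embeds_imp_contains_mesh:
  assumes "is_perm \<pi>" "is_perm \<rho>" "embeds \<pi> \<rho>"
  shows "contains_mesh \<rho> (classical \<pi>)"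
proof -
  define k where "k = length \<pi>"
  define n where "n = length \<rho>"
  obtain f where f: "f ` {1..k} \<subseteq> {1..n}" "strict_mono_on {1..k} f"
    "\<And>i j. i \<in> {1..k} \<Longrightarrow> j \<in> {1..k} \<Longrightarrow>
        perm_at \<pi> i < perm_at \<pi> j \<longleftrightarrow> perm_at \<rho> (f i) < perm_at \<rho> (f j)"
    using assms(3) unfolding embeds_def k_def n_def by blast
  have bij_\<pi>: "bij_betw (perm_at \<pi>) {1..k} {1..k}" and bij_\<rho>: "bij_betw (perm_at \<rho>) {1..n} {1..n}"
    using assms(1,2) unfolding k_def n_def by (blast intro: perm_at_bij_betw)+
  \<comment> \<open>\<open>h\<close> is the inverse permutation of \<pi>: it finds the position of a
    given value.\<close>
  define h where "h = inv_into {1..k} (perm_at \<pi>)"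
  have h_in: "h j \<in> {1..k}" and perm_at_h: "perm_at \<pi> (h j) = j" if "j \<in> {1..k}" for j
    using that bij_\<pi> unfolding h_def bij_betw_def
    by (metis inv_into_into, metis f_inv_into_f)
  have h_perm_at: "h (perm_at \<pi> i) = i" if "i \<in> {1..k}" for i
    using that bij_\<pi> unfolding h_def bij_betw_def by simp
  have f_in: "f i \<in> {1..n}" if "i \<in> {1..k}" for i
    using f(1) that by blast
  \<comment> \<open>The updates at 0 and \<open>k + 1\<close> install the boundary conventions; both
    arguments lie outside \<open>{1..k}\<close>, so the maps keep their values there.\<close>
  define \<alpha> where "\<alpha> = f(0 := 0, k + 1 := n + 1)"
  define \<beta> where "\<beta> = (\<lambda>j. perm_at \<rho> (f (h j)))(0 := 0, k + 1 := n + 1)"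
  have \<alpha>_eq: "\<alpha> i = f i" and \<beta>_eq: "\<beta> i = perm_at \<rho> (f (h i))" if "i \<in> {1..k}" for i
    using that by (auto simp: \<alpha>_def \<beta>_def)
  have \<alpha>: "\<alpha> ` {1..k} \<subseteq> {1..n}" "strict_mono_on {1..k} \<alpha>"
    using f(1,2) \<alpha>_eq by (auto simp: strict_mono_on_def)
  have "\<beta> j \<in> {1..n}" if "j \<in> {1..k}" for j
    using bij_betwE[OF bij_\<rho>] f_in h_in that by (metis \<beta>_eq)
  then have \<beta>_in: "\<beta> ` {1..k} \<subseteq> {1..n}"
    by blast
  have \<beta>_mono: "strict_mono_on {1..k} \<beta>"
  proof (rule strict_mono_onI)
    fix i j assume ij: "i \<in> {1..k}" "j \<in> {1..k}" "i < j"
    then show "\<beta> i < \<beta> j"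
      using f(3)[OF h_in h_in, of i j] by (simp add: perm_at_h \<beta>_eq)
  qed
  let ?\<omega> = "{(\<alpha> i, \<beta> j) | i j. (i, j) \<in> plot \<pi>}"
  have "?\<omega> \<subseteq> plot \<rho>"
  proof
    fix p assume "p \<in> ?\<omega>"
    then obtain i where i: "i \<in> {1..k}" "p = (\<alpha> i, \<beta> (perm_at \<pi> i))"
      unfolding plot_def k_def by blast
    then have "p = (f i, perm_at \<rho> (f i))"
      using bij_betwE[OF bij_\<pi>] by (metis \<alpha>_eq \<beta>_eq h_perm_at)
    then show "p \<in> plot \<rho>"
      using f_in[OF i(1)] unfolding plot_def n_def by blast
  qed
  moreover have "\<alpha> 0 = 0 \<and> \<beta> 0 = 0 \<and> \<alpha> (k + 1) = n + 1 \<and> \<beta> (k + 1) = n + 1"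
    by (simp add: \<alpha>_def \<beta>_def)
  ultimately have "occurrence (classical \<pi>) \<rho> ?\<omega>"
    using \<alpha> \<beta>_in \<beta>_mono unfolding occurrence_def Let_def prod.case k_def n_def by blast
  then show ?thesis
    unfolding contains_mesh_def by blast
qed

section \<open>Inserting a point into an occurrence\<close>

text \<open>One operation with three uses: it adds x to the position map \<alpha>, adds y to the
  value map \<beta>, and describes the entries of \<open>insert_point\<close> itself.\<close>

definition insert_fun :: "(nat \<Rightarrow> nat) \<Rightarrow> nat \<Rightarrow> nat \<Rightarrow> nat \<Rightarrow> nat" where
  "insert_fun \<alpha> a x i = (if i \<le> a then \<alpha> i else if i = a + 1 then x else \<alpha> (i - 1))"

text \<open>Comparing x with its two neighbours suffices, by monotonicity of \<alpha>. The guards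
  cover the ends, where a neighbour falls outside \<open>{1..k}\<close>.\<close>

lemma strict_mono_on_insert_fun:
  assumes "strict_mono_on {1..k} \<alpha>" "1 \<le> a \<Longrightarrow> \<alpha> a < x" "a < k \<Longrightarrow> x < \<alpha> (a + 1)" "a \<le> k"
  shows "strict_mono_on {1..k + 1} (insert_fun \<alpha> a x)"
proof (rule strict_mono_onI)
  fix i j assume ij: "i \<in> {1..k + 1}" "j \<in> {1..k + 1}" "i < j"
  have less: "\<alpha> i < \<alpha> j" if "1 \<le> i" "i < j" "j \<le> k" for i j
    using assms(1) that by (simp add: strict_mono_on_def)
  have below: "\<alpha> i < x" if "1 \<le> i" "i \<le> a" for i
    using less[of i a] assms(2,4) that by (cases "i = a") auto
  have above: "x < \<alpha> j" if "a < j" "j \<le> k" for j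
    using less[of "a + 1" j] assms(3) that by (cases "j = a + 1") auto
  consider "j \<le> a" | "j = a + 1" | "a + 1 < j" "i \<le> a" | "a + 1 < j" "i = a + 1"
    | "a + 1 < j" "a + 1 < i"
    by linarith
  then show "insert_fun \<alpha> a x i < insert_fun \<alpha> a x j"
  proof cases
    case 3
    then have "\<alpha> i < x" "x < \<alpha> (j - 1)"
      using below above ij by auto
    with 3 show ?thesis by (simp add: insert_fun_def)
  qed (use less below above ij assms(4) in \<open>auto simp: insert_fun_def\<close>)
qed

lemma length_insert_point: "length (insert_point \<sigma> (a, b)) = length \<sigma> + 1"
  by (simp add: insert_point_def Let_def del: upt_Suc)

lemma perm_at_insert_point:
  assumes "i \<in> {1..length \<sigma> + 1}"
  shows "perm_at (insert_point \<sigma> (a, b)) i =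
    insert_fun (\<lambda>k. if perm_at \<sigma> k \<le> b then perm_at \<sigma> k else perm_at \<sigma> k + 1) a (b + 1) i"
proof -
  have "i - 1 < length [1..<length \<sigma> + 2]" "[1..<length \<sigma> + 2] ! (i - 1) = i"
    using assms by (auto simp del: upt_Suc)
  \<comment> \<open>Instantiating \<open>perm_at_def\<close> at \<open>map _ _\<close> unfolds only
    the outer lookup and leaves the entries \<open>perm_at \<sigma>\<close> folded.\<close>
  then show ?thesis
    by (simp add: insert_point_def Let_def perm_at_def[of "map _ _"] insert_fun_def del: upt_Suc)
qed

text \<open>Extend \<alpha> by x and \<beta> by y to \<open>?f\<close> and \<open>?g\<close>. Then
  \<rho> after \<open>?f\<close> equals \<open>?g\<close> after the enlarged permutation, and since
  \<open>?g\<close> is strictly increasing, \<open>?f\<close> preserves and reflects the order of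
  entries.\<close>

lemma embeds_insert_point:
  assumes "is_perm \<sigma>" and "a \<le> length \<sigma>" "b \<le> length \<sigma>"
    and \<alpha>: "\<alpha> ` {1..length \<sigma>} \<subseteq> {1..length \<rho>}" "strict_mono_on {1..length \<sigma>} \<alpha>"
    and \<beta>: "strict_mono_on {1..length \<sigma>} \<beta>"
    and image: "\<And>i. i \<in> {1..length \<sigma>} \<Longrightarrow> perm_at \<rho> (\<alpha> i) = \<beta> (perm_at \<sigma> i)"
    and xy: "(x, y) \<in> plot \<rho>" "\<alpha> a < x" "x < \<alpha> (a + 1)" "\<beta> b < y" "y < \<beta> (b + 1)"
  shows "embeds (insert_point \<sigma> (a, b)) \<rho>"
proof -
  let ?k = "length \<sigma>"
  let ?\<sigma>' = "insert_point \<sigma> (a, b)"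
  let ?f = "insert_fun \<alpha> a x"
  let ?g = "insert_fun \<beta> b y"
  have x_in: "x \<in> {1..length \<rho>}" and y: "perm_at \<rho> x = y"
    using xy(1) by (auto simp: plot_def)
  have \<sigma>_in: "perm_at \<sigma> i \<in> {1..?k}" if "i \<in> {1..?k}" for i
    using bij_betwE[OF perm_at_bij_betw[OF assms(1)]] that by blast
  have f_mono: "strict_mono_on {1..?k + 1} ?f" and g_mono: "strict_mono_on {1..?k + 1} ?g"
    using strict_mono_on_insert_fun[OF \<alpha>(2) xy(2,3) assms(2)]
      strict_mono_on_insert_fun[OF \<beta> xy(4,5) assms(3)] .
  \<comment> \<open>Each position of the enlarged permutation is either the new one or comes from an
    old position \<open>i'\<close>, moved right by one if it lies beyond a.\<close>
  have cases: "i = a + 1 \<or> (\<exists>i' \<in> {1..?k}. i = (if i' \<le> a then i' else i' + 1))"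
    if "i \<in> {1..?k + 1}" for i
  proof -
    consider "i \<le> a" | "i = a + 1" | "a + 1 < i" by linarith
    then show ?thesis
    proof cases
      case 1
      then show ?thesis using that assms(2) by (intro disjI2 bexI[of _ i]) auto
    next
      case 3
      then show ?thesis using that by (intro disjI2 bexI[of _ "i - 1"]) auto
    qed simp
  qed
  have f_in: "?f i \<in> {1..length \<rho>}" if "i \<in> {1..?k + 1}" for i
    using cases[OF that] \<alpha>(1) x_in by (auto simp: insert_fun_def image_subset_iff)
  have \<sigma>'_in: "perm_at ?\<sigma>' i \<in> {1..?k + 1}"
    and f_image: "perm_at \<rho> (?f i) = ?g (perm_at ?\<sigma>' i)" if i: "i \<in> {1..?k + 1}" for i
  proof -
    have "perm_at ?\<sigma>' i \<in> {1..?k + 1} \<and> perm_at \<rho> (?f i) = ?g (perm_at ?\<sigma>' i)"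
      using cases[OF i]
    proof
      assume "i = a + 1"
      then show ?thesis
        using i y assms(3) by (simp add: perm_at_insert_point insert_fun_def)
    next
      assume "\<exists>i' \<in> {1..?k}. i = (if i' \<le> a then i' else i' + 1)"
      then obtain i' where i': "i' \<in> {1..?k}" "i = (if i' \<le> a then i' else i' + 1)" by blast
      have "?f i = \<alpha> i'"
        using i'(2) by (simp add: insert_fun_def)
      moreover have "perm_at ?\<sigma>' i = (if perm_at \<sigma> i' \<le> b then perm_at \<sigma> i' else perm_at \<sigma> i' + 1)"
        using i i'(2) by (simp add: perm_at_insert_point insert_fun_def)
      \<comment> \<open>The raising of values above b cancels the shift in \<open>?g\<close>: an old
        value v \<le> b stays v, and v > b becomes v + 1 > b + 1, so in both cases \<open>?g\<close>
        returns \<beta> v.\<close>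
      ultimately show ?thesis
        using image[OF i'(1)] \<sigma>_in[OF i'(1)] by (auto simp: insert_fun_def)
    qed
    then show "perm_at ?\<sigma>' i \<in> {1..?k + 1}" "perm_at \<rho> (?f i) = ?g (perm_at ?\<sigma>' i)"
      by blast+
  qed
  have "perm_at ?\<sigma>' i < perm_at ?\<sigma>' j \<longleftrightarrow> perm_at \<rho> (?f i) < perm_at \<rho> (?f j)"
    if "i \<in> {1..?k + 1}" "j \<in> {1..?k + 1}" for i j
    using strict_mono_on_less[OF g_mono \<sigma>'_in[OF that(1)] \<sigma>'_in[OF that(2)]] f_image that by simp
  then show ?thesis
    unfolding embeds_def length_insert_point using f_in f_mono by blast
qed

section \<open>Changing the mesh by one box\<close>

lemma contains_mesh_antimono:
  assumes "contains_mesh \<rho> (\<tau>, R')" "R \<subseteq> R'"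
  shows "contains_mesh \<rho> (\<tau>, R)"
proof -
  \<comment> \<open>Keeping \<open>P\<close> arbitrary allows the box condition to be restricted for
    whichever \<alpha> and \<beta> the occurrence supplies.\<close>
  have "\<forall>p \<in> R. P p" if "\<forall>p \<in> R'. P p" for P
    using that assms(2) by blast
  then show ?thesis
    using assms(1) unfolding contains_mesh_def occurrence_def Let_def prod.case
    by (elim exE conjE) (intro exI conjI; assumption)
qed

text \<open>Fix an occurrence with its maps. If the region of (a, b) is empty, the same occurrence
  serves the larger mesh; otherwise any point in that region can be inserted.\<close>

lemma contains_mesh_insert_box:
  assumes "is_perm \<sigma>" "a \<le> length \<sigma>" "b \<le> length \<sigma>" "contains_mesh \<rho> (\<sigma>, R)"
  shows "contains_mesh \<rho> (\<sigma>, R \<union> {(a, b)}) \<or> embeds (insert_point \<sigma> (a, b)) \<rho>"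
proof -
  let ?k = "length \<sigma>" and ?n = "length \<rho>"
  let ?box = "\<lambda>\<alpha> \<beta> i j. {\<alpha> i + 1 .. \<alpha> (i + 1) - 1} \<times> {\<beta> j + 1 .. \<beta> (j + 1) - (1 :: nat)}"
  obtain \<omega> \<alpha> \<beta> where occ: "\<omega> \<subseteq> plot \<rho>" "\<alpha> ` {1..?k} \<subseteq> {1..?n}" "strict_mono_on {1..?k} \<alpha>"
    "\<beta> ` {1..?k} \<subseteq> {1..?n}" "strict_mono_on {1..?k} \<beta>"
    "\<omega> = {(\<alpha> i, \<beta> j) | i j. (i, j) \<in> plot \<sigma>}"
    "\<alpha> 0 = 0" "\<beta> 0 = 0" "\<alpha> (?k + 1) = ?n + 1" "\<beta> (?k + 1) = ?n + 1"
    "\<forall>(i, j) \<in> R. ?box \<alpha> \<beta> i j \<inter> plot \<rho> = {}"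
    using assms(4) unfolding contains_mesh_def occurrence_def Let_def prod.case
    by (elim exE conjE) (rule that; assumption)
  show ?thesis
  proof (cases "?box \<alpha> \<beta> a b \<inter> plot \<rho> = {}")
    case True
    have "\<forall>(i, j) \<in> R \<union> {(a, b)}. ?box \<alpha> \<beta> i j \<inter> plot \<rho> = {}"
      using occ(11) True by (simp add: ball_Un)
    with occ(1-10) have "occurrence (\<sigma>, R \<union> {(a, b)}) \<rho> \<omega>"
      unfolding occurrence_def Let_def prod.case
      by - (intro conjI exI[of _ \<alpha>] exI[of _ \<beta>]; assumption)
    then show ?thesis
      unfolding contains_mesh_def by blast
  next
    case False
    then obtain x y where xy: "(x, y) \<in> plot \<rho>" "(x, y) \<in> ?box \<alpha> \<beta> a b"
      by (metis disjoint_iff surj_pair)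
    \<comment> \<open>The occurrence consists of points of the plot of \<rho>, so its position and
      value maps agree along \<sigma>.\<close>
    have "perm_at \<rho> (\<alpha> i) = \<beta> (perm_at \<sigma> i)" if "i \<in> {1..?k}" for i
    proof -
      have "(\<alpha> i, \<beta> (perm_at \<sigma> i)) \<in> plot \<rho>"
        using that occ(1,6) unfolding plot_def by blast
      then show ?thesis by (simp add: plot_def)
    qed
    \<comment> \<open>A point of the box has positive coordinates, so the upper bounds ending in
      \<open>- 1\<close> are not truncated and the inequalities are strict.\<close>
    moreover have "\<alpha> a < x" "x < \<alpha> (a + 1)" "\<beta> b < y" "y < \<beta> (b + 1)"
      using xy(2) by auto
    ultimately show ?thesis
      using embeds_insert_point[OF assms(1-3) occ(2,3,5) _ xy(1)] by blast
  qed
qed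

theorem proposition3p5:
  fixes \<sigma> \<pi> :: permutation and m1 m2 :: mesh_pattern
    and R1 R2 :: "(nat \<times> nat) set" and a b :: nat
  assumes "is_perm \<sigma>" and "is_perm \<pi>"
    and "m1 = (\<sigma>, R1)" and "m2 = (\<sigma>, R2)"
    and "is_mesh_pattern m1" and "is_mesh_pattern m2"
    and "length \<pi> \<le> length \<sigma> + 1"
    and "(a, b) \<in> {0..length \<sigma>} \<times> {0..length \<sigma>}"
    and "R2 = R1 \<union> {(a, b)}"
    and "\<pi> \<preceq> insert_point \<sigma> (a, b)"
  shows "coincident_under \<pi> m1 m2"
proof -
  have box: "a \<le> length \<sigma>" "b \<le> length \<sigma>"
    using assms(8) by auto
  \<comment> \<open>Equality of the two avoidance sets is checked separately for each permutation
    \<rho>, in terms of containing some forbidden pattern.\<close>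
  have "contains_mesh \<rho> (classical \<pi>) \<or> contains_mesh \<rho> m1 \<longleftrightarrow>
      contains_mesh \<rho> (classical \<pi>) \<or> contains_mesh \<rho> m2" if "is_perm \<rho>" for \<rho>
  proof -
    have "contains_mesh \<rho> m1" if "contains_mesh \<rho> m2"
      using that contains_mesh_antimono assms(3,4,9) by blast
    \<comment> \<open>This settles the case of an occupied box: \<pi> embeds into the enlarged
      \<sigma>, which embeds into \<rho>.\<close>
    moreover have "contains_mesh \<rho> (classical \<pi>)" if "embeds (insert_point \<sigma> (a, b)) \<rho>"
      using embeds_imp_contains_mesh[OF assms(2) \<open>is_perm \<rho>\<close>]
        embeds_trans[OF pattern_le_imp_embeds[OF assms(10)] that] by blast
    ultimately show ?thesis
      using contains_mesh_insert_box[OF assms(1) box] assms(3,4,9) by blast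
  qed
  then show ?thesis
    unfolding coincident_under_def Av_def by blast
qed

end
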